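(* Let $\mathbb{F}$ be a field, $V$ be an $\mathbb{F}$-vector space with $\dim V=2n\geq 4$ and $|\mathbb{F}|>2n-2$, let $s$ be a symplectic form on $V$, and let $\mathbb{L}=\mathbb{F}[a]$ be a quadratic extension of $\mathbb{F}$ in $\mathrm{End}(V)$. For $\mathcal{A}_s\cap\mathcal{A}_{s_a}$ to be an optimal trivial spectrum subspace of $\mathcal{A}_s$, it is necessary and sufficient that $s_a$ be nonisotropic.
   Context: A symplectic form is a non-degenerate alternating bilinear form. For a bilinear form $b$ on $V$, $\mathcal{A}_b:=\{u\in\mathrm{End}(V):b(x,u(x))=0\ \forall x\in V\}$; $b$ is nonisotropic when $b(x,x)\neq0$ for all $x\neq0$. For $\lambda\in\mathrm{End}(V)$, $s_\lambda:(x,y)\mapsto s(x,\lambda(y))$. A linear subspace $S$ of $\mathrm{End}(V)$ has trivial spectrum when $\mathrm{id}_V-u$ is invertible for all $u\in S$. A trivial spectrum linear subspace of $\mathcal{A}_s$ is optimal when it has the greatest possible dimension among trivial spectrum linear subspaces of $\mathcal{A}_s$. A quadratic extension $\mathbb{L}=\mathbb{F}[a]$ of $\mathbb{F}$ in $\mathrm{End}(V)$ is a subalgebra of $\mathrm{End}(V)$ containing $\mathbb{F}\,\mathrm{id}_V$ (identified with $\mathbb{F}$) that is a field of degree $2$ over $\mathbb{F}$; $a$ then has irreducible minimal polynomial of degree $2$. *)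

theory Defs
  imports Complex_Main "HOL-Library.Function_Algebras"
begin

text \<open>
  An \<open>F\<close>-vector space is given by a scalar multiplication \<open>scale\<close> satisfying the library
  predicate \<open>vector_space\<close>, with the field and the vectors as types. Endomorphisms are functions
  \<open>'v \<Rightarrow> 'v\<close> satisfying the library predicate \<open>Vector_Spaces.linear\<close>; their addition is the
  pointwise one of \<open>Function_Algebras\<close>, and their product is composition (not the pointwise
  product of \<open>Function_Algebras\<close>).
\<close>

definition End :: "('f::field \<Rightarrow> 'v::ab_group_add \<Rightarrow> 'v) \<Rightarrow> ('v \<Rightarrow> 'v) set" where
  "End scale = {u. Vector_Spaces.linear scale scale u}"

definition fun_scale :: "('f::field \<Rightarrow> 'v::ab_group_add \<Rightarrow> 'v) \<Rightarrow> 'f \<Rightarrow> ('v \<Rightarrow> 'v) \<Rightarrow> ('v \<Rightarrow> 'v)" where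
  "fun_scale scale c u = (\<lambda>x. scale c (u x))"

lemma vector_space_fun_scale:
  assumes "vector_space scale"
  shows "vector_space (fun_scale scale)"
proof -
  interpret vector_space scale by fact
  show ?thesis
    by unfold_locales
      (auto simp: fun_scale_def fun_eq_iff scale_right_distrib scale_left_distrib)
qed

lemma subspace_End:
  assumes "vector_space scale"
  shows "module.subspace (fun_scale scale) (End scale)"
proof -
  interpret vector_space scale by fact
  interpret E: vector_space "fun_scale scale" by (rule vector_space_fun_scale) fact
  interpret P: vector_space_pair scale scale ..
  show ?thesis
    by (auto simp: E.subspace_def End_def fun_scale_def zero_fun_def plus_fun_def
        P.linear_0 P.linear_zero P.linear_compose_add P.linear_compose_scale_right)
qed

definition end_subspace ::
  "('f::field \<Rightarrow> 'v::ab_group_add \<Rightarrow> 'v) \<Rightarrow> ('v \<Rightarrow> 'v) set \<Rightarrow> bool" where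
  "end_subspace scale S \<longleftrightarrow> S \<subseteq> End scale \<and> module.subspace (fun_scale scale) S"

definition end_dim :: "('f::field \<Rightarrow> 'v::ab_group_add \<Rightarrow> 'v) \<Rightarrow> ('v \<Rightarrow> 'v) set \<Rightarrow> nat" where
  "end_dim scale S = vector_space.dim (fun_scale scale) S"

definition end_invertible ::
  "('f::field \<Rightarrow> 'v::ab_group_add \<Rightarrow> 'v) \<Rightarrow> ('v \<Rightarrow> 'v) \<Rightarrow> bool" where
  "end_invertible scale u \<longleftrightarrow> (\<exists>v\<in>End scale. u \<circ> v = id \<and> v \<circ> u = id)"

definition bilinear_form ::
  "('f::field \<Rightarrow> 'v::ab_group_add \<Rightarrow> 'v) \<Rightarrow> ('v \<Rightarrow> 'v \<Rightarrow> 'f) \<Rightarrow> bool" where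
  "bilinear_form scale b \<longleftrightarrow>
     (\<forall>x. Vector_Spaces.linear scale (*) (\<lambda>y. b x y)) \<and>
     (\<forall>y. Vector_Spaces.linear scale (*) (\<lambda>x. b x y))"

definition alternating :: "('v \<Rightarrow> 'v \<Rightarrow> 'f::zero) \<Rightarrow> bool" where
  "alternating b \<longleftrightarrow> (\<forall>x. b x x = 0)"

definition nondegenerate :: "('v::zero \<Rightarrow> 'v \<Rightarrow> 'f::zero) \<Rightarrow> bool" where
  "nondegenerate b \<longleftrightarrow>
     (\<forall>x. (\<forall>y. b x y = 0) \<longrightarrow> x = 0) \<and> (\<forall>y. (\<forall>x. b x y = 0) \<longrightarrow> y = 0)"

definition symplectic_form ::
  "('f::field \<Rightarrow> 'v::ab_group_add \<Rightarrow> 'v) \<Rightarrow> ('v \<Rightarrow> 'v \<Rightarrow> 'f) \<Rightarrow> bool" where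
  "symplectic_form scale s \<longleftrightarrow> bilinear_form scale s \<and> alternating s \<and> nondegenerate s"

definition nonisotropic :: "('v::zero \<Rightarrow> 'v \<Rightarrow> 'f::zero) \<Rightarrow> bool" where
  "nonisotropic b \<longleftrightarrow> (\<forall>x. x \<noteq> 0 \<longrightarrow> b x x \<noteq> 0)"

definition twist :: "('v \<Rightarrow> 'v \<Rightarrow> 'f) \<Rightarrow> ('v \<Rightarrow> 'v) \<Rightarrow> 'v \<Rightarrow> 'v \<Rightarrow> 'f" where
  "twist s l = (\<lambda>x y. s x (l y))"

definition alt_end ::
  "('f::field \<Rightarrow> 'v::ab_group_add \<Rightarrow> 'v) \<Rightarrow> ('v \<Rightarrow> 'v \<Rightarrow> 'f) \<Rightarrow> ('v \<Rightarrow> 'v) set" where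
  "alt_end scale b = {u \<in> End scale. \<forall>x. b x (u x) = 0}"

definition trivial_spectrum ::
  "('f::field \<Rightarrow> 'v::ab_group_add \<Rightarrow> 'v) \<Rightarrow> ('v \<Rightarrow> 'v) set \<Rightarrow> bool" where
  "trivial_spectrum scale S \<longleftrightarrow>
     end_subspace scale S \<and> (\<forall>u\<in>S. end_invertible scale (id - u))"

definition optimal_trivial_spectrum ::
  "('f::field \<Rightarrow> 'v::ab_group_add \<Rightarrow> 'v) \<Rightarrow> ('v \<Rightarrow> 'v \<Rightarrow> 'f) \<Rightarrow> ('v \<Rightarrow> 'v) set \<Rightarrow> bool" where
  "optimal_trivial_spectrum scale s S \<longleftrightarrow>
     trivial_spectrum scale S \<and> S \<subseteq> alt_end scale s \<and>
     (\<forall>T. trivial_spectrum scale T \<and> T \<subseteq> alt_end scale s \<longrightarrow> end_dim scale T \<le> end_dim scale S)"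

text \<open>As \<open>L\<close> is a subspace, \<open>id \<in> L\<close> says that \<open>L\<close> contains all the scalar multiples of \<open>id\<close>.\<close>

definition end_subalgebra ::
  "('f::field \<Rightarrow> 'v::ab_group_add \<Rightarrow> 'v) \<Rightarrow> ('v \<Rightarrow> 'v) set \<Rightarrow> bool" where
  "end_subalgebra scale L \<longleftrightarrow>
     end_subspace scale L \<and> id \<in> L \<and> (\<forall>u\<in>L. \<forall>v\<in>L. u \<circ> v \<in> L)"

text \<open>
  Only the field axioms that are not inherited from the ring of endomorphisms are listed.
\<close>

definition quadratic_extension ::
  "('f::field \<Rightarrow> 'v::ab_group_add \<Rightarrow> 'v) \<Rightarrow> ('v \<Rightarrow> 'v) set \<Rightarrow> bool" where
  "quadratic_extension scale L \<longleftrightarrow>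
     end_subalgebra scale L \<and>
     (id :: 'v \<Rightarrow> 'v) \<noteq> 0 \<and>
     (\<forall>u\<in>L. \<forall>v\<in>L. u \<circ> v = v \<circ> u) \<and>
     (\<forall>u\<in>L. u \<noteq> 0 \<longrightarrow> (\<exists>v\<in>L. u \<circ> v = id)) \<and>
     end_dim scale L = 2"

text \<open>\<open>F[a]\<close>: the polynomial expressions in \<open>a\<close>, i.e. the span of its iterates.\<close>

definition adjoin ::
  "('f::field \<Rightarrow> 'v::ab_group_add \<Rightarrow> 'v) \<Rightarrow> ('v \<Rightarrow> 'v) \<Rightarrow> ('v \<Rightarrow> 'v) set" where
  "adjoin scale a = module.span (fun_scale scale) (range (\<lambda>k::nat. a ^^ k))"

end

theory Submission
  imports Defs
begin

text \<open>
  Let \<open>A\<close> be the intersection in question. If \<open>x \<noteq> 0\<close> is isotropic for \<open>s\<^sub>a\<close>, then an explicit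
  element of rank at most four of \<open>A\<close> fixes \<open>x\<close>. Conversely, \<open>u x = x\<close> with \<open>u \<in> A\<close> gives
  \<open>s\<^sub>a x x = 0\<close>, so \<open>A\<close> has trivial spectrum as soon as \<open>s\<^sub>a\<close> is nonisotropic; and \<open>A\<close>, which
  corresponds to the alternating \<open>F[a]\<close>-bilinear forms, has dimension at least \<open>n (n - 1)\<close>.

  It remains to see that a trivial spectrum subspace \<open>S\<close> of \<open>A\<^sub>s\<close> has dimension at most
  \<open>n (n - 1)\<close>. Choose \<open>x\<close> with \<open>dim (S x)\<close> maximal. As \<open>S x\<close> is orthogonal to \<open>x\<close> and does not
  contain \<open>x\<close>, its dimension is at most \<open>2 n - 2 < |F|\<close>, and then, by maximality, every \<open>u \<in> S\<close>
  with \<open>u x = 0\<close> maps into \<open>S x\<close>. Hence such a \<open>u\<close> is determined by the operator it induces on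
  \<open>x\<^sup>\<bottom> / F x\<close>, and induction on \<open>n\<close> gives
  \<open>dim S \<le> (2 n - 2) + (n - 1) (n - 2) = n (n - 1)\<close>.
\<close>

section \<open>Linear pencils of bounded rank\<close>

context finite_dimensional_vector_space
begin

lemma exists_kernel_vector_if_dim_image_less:
  assumes f: "Vector_Spaces.linear scale scale f" and "dim (f ` S) < dim S"
  shows "\<exists>w\<in>span S. w \<noteq> 0 \<and> f w = 0"
proof -
  interpret P: finite_dimensional_vector_space_pair_1 scale Basis scale
    by unfold_locales
  have "\<not> inj_on f (span S)"
    using P.dim_image_eq[OF f, of S] assms(2) by auto
  then show ?thesis
    using P.linear_inj_on_iff_eq_0[OF f subspace_span, of S] by auto
qed

text \<open>Eigenvectors for distinct eigenvalues are independent: applying \<open>t - f\<close> to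
  an expression of \<open>v t\<close> through the other \<open>v j\<close> gives zero on the left
  and multiplies each coefficient by \<open>t - j\<close>, which is nonzero.\<close>

lemma card_eigenvalues_le_dim:
  assumes f: "Vector_Spaces.linear scale scale f"
    and "finite T"
    and eig: "\<And>t. t \<in> T \<Longrightarrow> v t \<in> S \<and> v t \<noteq> 0 \<and> f (v t) = scale t (v t)"
  shows "card T \<le> dim S"
proof -
  interpret f: Vector_Spaces.linear scale scale f by fact
  have "independent (v ` T) \<and> inj_on v T"
    using \<open>finite T\<close> eig
  proof (induction T rule: finite_induct)
    case empty
    then show ?case by (simp add: independent_empty)
  next
    case (insert t T)
    then have IH: "independent (v ` T)" "inj_on v T"
      by auto
    have "v t \<notin> span (v ` T)"
    proof
      assume "v t \<in> span (v ` T)"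
      then obtain c where "v t = (\<Sum>w\<in>v ` T. scale (c w) w)"
        using insert.hyps by (auto simp: span_finite)
      then have c: "v t = (\<Sum>j\<in>T. scale (c (v j)) (v j))"
        by (simp add: sum.reindex[OF IH(2)])
      have "0 = scale t (v t) - f (v t)"
        using insert.prems by simp
      also have "f (v t) = (\<Sum>j\<in>T. scale (c (v j)) (scale j (v j)))"
        using insert.prems by (subst c) (simp add: f.sum f.scale)
      also have "scale t (v t) - \<dots> = (\<Sum>j\<in>T. scale ((t - j) * c (v j)) (v j))"
        by (subst c) (simp add: scale_sum_right sum_subtractf scale_left_diff_distrib algebra_simps)
      \<comment> \<open>\<open>independentD\<close> sums over vectors, so the factor
        \<open>t - j\<close> has to be written in terms of the vector;
        \<open>the_inv_into T v\<close> recovers the eigenvalue.\<close>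
      also have "\<dots> = (\<Sum>w\<in>v ` T. scale ((t - the_inv_into T v w) * c w) w)"
        by (simp add: sum.reindex[OF IH(2)] the_inv_into_f_f[OF IH(2)])
      finally have "(t - the_inv_into T v w) * c w = 0" if "w \<in> v ` T" for w
        using independentD[OF IH(1), of "v ` T" "\<lambda>w. (t - the_inv_into T v w) * c w" w] insert.hyps that
        by auto
      then have "(t - j) * c (v j) = 0" if "j \<in> T" for j
        using that the_inv_into_f_f[OF IH(2)] by fastforce
      then have "c (v j) = 0" if "j \<in> T" for j
        using that insert.hyps(2) by fastforce
      then have "v t = 0"
        by (subst c) simp
      then show False
        using insert.prems by simp
    qed
    moreover have "v t \<notin> v ` T"
      using calculation by (blast intro: span_base)
    ultimately show ?case
      using IH insert.hyps(2) by (simp add: independent_insertI)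
  qed
  moreover have "v ` T \<subseteq> S"
    using eig by auto
  ultimately show ?thesis
    using independent_card_le_dim[of "v ` T" S] card_image[of v T] by simp
qed

text \<open>If \<open>g e\<close> were outside the range of \<open>f\<close>, then the pencil \<open>g + t f\<close> would be singular
  for every \<open>t\<close> on a space of dimension \<open>dim (f ` K) + 1\<close>, which makes every scalar
  an eigenvalue of an operator of rank at most \<open>dim (f ` K)\<close>.\<close>

lemma kernel_image_in_range_if_rank_maximal:
  assumes E: "vector_space scaleE"
    and f: "Vector_Spaces.linear scaleE scale f" and g: "Vector_Spaces.linear scaleE scale g"
    and K: "module.subspace scaleE K"
    and max: "\<And>t. dim ((\<lambda>k. g k + scale t (f k)) ` K) \<le> dim (f ` K)"
    and card: "infinite (UNIV :: 'a set) \<or> card (UNIV :: 'a set) > dim (f ` K)"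
    and e: "e \<in> K" "f e = 0"
  shows "g e \<in> f ` K"
proof (rule ccontr)
  assume ge: "g e \<notin> f ` K"
  interpret E: vector_space scaleE by fact
  interpret VE: vector_space_pair scale scaleE by unfold_locales
  interpret VV: vector_space_pair scale scale by unfold_locales
  interpret f: Vector_Spaces.linear scaleE scale f by fact
  interpret g: Vector_Spaces.linear scaleE scale g by fact
  have fK: "subspace (f ` K)"
    by (rule f.subspace_image[OF K])
  obtain C where C: "finite C" "C \<subseteq> f ` K" "independent C" "span C = f ` K"
    using basis_subspace_exists[OF fK] by metis
  have "\<forall>c\<in>C. \<exists>k\<in>K. f k = c"
    using C by auto
  then obtain l where l: "\<And>c. c \<in> C \<Longrightarrow> l c \<in> K \<and> f (l c) = c"
    by metis
  define D where "D = insert (g e) C"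
  have D: "independent D"
    unfolding D_def using C ge by (simp add: independent_insertI)
  have geC: "g e \<notin> C"
    using ge C by auto
  \<comment> \<open>\<open>h\<close> is a section of \<open>f\<close> over \<open>span C\<close>
    that also sends the additional vector \<open>g e\<close> to \<open>e\<close>. The pencil can
    thus be studied on \<open>span D\<close>, whose dimension exceeds the rank of \<open>f\<close>
    on \<open>K\<close> by one.\<close>
  obtain h where h: "Vector_Spaces.linear scale scaleE h"
    and hD: "\<And>d. d \<in> D \<Longrightarrow> h d = (if d = g e then e else l d)"
    using VE.linear_independent_extend[OF D, of "\<lambda>d. if d = g e then e else l d"] by auto
  interpret h: Vector_Spaces.linear scale scaleE h by fact
  have hK: "h w \<in> K" if "w \<in> span D" for w
  proof -
    have "h ` span D = E.span (h ` D)"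
      using h.span_image by simp
    also have "\<dots> \<subseteq> K"
      using hD l e by (intro E.span_minimal K) (auto simp: D_def)
    finally show ?thesis using that by auto
  qed
  have fh: "f (h v) = v" if "v \<in> span C" for v
  proof (rule VV.linear_eq_on[OF _ _ that, where f = "\<lambda>v. f (h v)" and g = "\<lambda>v. v"])
    show "Vector_Spaces.linear scale scale (\<lambda>v. f (h v))"
      using Vector_Spaces.linear_compose[OF h f] by (simp add: o_def)
    show "Vector_Spaces.linear scale scale (\<lambda>v. v)"
      using linear_ident by simp
    show "f (h b) = b" if "b \<in> C" for b
      using that l hD geC by (auto simp: D_def)
  qed
  \<comment> \<open>On \<open>span D\<close> this is the projection onto \<open>span C\<close> along
    \<open>g e\<close>.\<close>
  define p where "p = f \<circ> h"
  have p: "Vector_Spaces.linear scale scale p"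
    unfolding p_def using Vector_Spaces.linear_compose[OF h f] .
  interpret p: Vector_Spaces.linear scale scale p by fact
  have he: "h (g e) = e"
    using hD by (simp add: D_def)
  have pge: "p (g e) = 0"
    using he e by (simp add: p_def)
  \<comment> \<open>A kernel vector \<open>w = v + b (g e)\<close> of the pencil satisfies
    \<open>g (h v) + b (g e) + t v = 0\<close>, and \<open>p\<close> turns this into an eigenvalue
    equation for \<open>v\<close>. Were \<open>v\<close> zero, \<open>b (g e)\<close> would vanish
    with \<open>b\<close> nonzero, so \<open>g e = 0\<close> would lie in the range.\<close>
  have "\<exists>v. v \<in> span C \<and> v \<noteq> 0 \<and> p (g (h v)) = scale (- t) v" for t
  proof -
    define q where "q = (\<lambda>w. g (h w) + scale t (f (h w)))"
    have q: "Vector_Spaces.linear scale scale q"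
      unfolding q_def Vector_Spaces.linear_iff
      by (auto simp: vector_space_axioms g.add h.add f.add g.scale h.scale f.scale
          algebra_simps)
    have "dim (q ` D) \<le> dim ((\<lambda>k. g k + scale t (f k)) ` K)"
      using hK by (intro dim_subset) (auto simp: q_def intro: span_base)
    also have "\<dots> \<le> dim (f ` K)" by (rule max)
    also have "\<dots> = dim C"
      using C dim_span[of C] by simp
    also have "\<dots> < dim D"
      using ge C by (simp add: D_def dim_insert)
    finally obtain w where w: "w \<in> span D" "w \<noteq> 0" "q w = 0"
      using exists_kernel_vector_if_dim_image_less[OF q] by blast
    then obtain b where b: "w - scale b (g e) \<in> span C"
      by (auto simp: D_def span_breakdown_eq)
    define v where "v = w - scale b (g e)"
    have w_eq: "w = v + scale b (g e)"
      by (simp add: v_def)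
    have v: "v \<in> span C" using b by (simp add: v_def)
    have hw: "h w = h v + scaleE b e"
      by (simp add: w_eq h.add h.scale he)
    have qw: "g (h v) + scale b (g e) + scale t v = 0"
      using w(3) fh[OF v] by (simp add: q_def hw g.add g.scale f.add f.scale e(2))
    have "v \<noteq> 0"
    proof
      assume "v = 0"
      then have "b \<noteq> 0" "scale b (g e) = 0"
        using w(2) qw by (auto simp: w_eq)
      then show False
        using ge subspace_0[OF fK] by simp
    qed
    moreover have "p (g (h v) + scale b (g e) + scale t v) = p (g (h v)) + scale t v"
      using fh[OF v] by (simp add: p.add p.scale pge) (simp add: p_def)
    then have "p (g (h v)) = scale (- t) v"
      using qw by (simp add: eq_neg_iff_add_eq_0)
    ultimately show ?thesis using v by blast
  qed
  then obtain v where v: "\<And>t. v t \<in> span C \<and> v t \<noteq> 0 \<and> p (g (h (v t))) = scale (- t) (v t)"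
    by metis
  obtain T :: "'a set" where T: "finite T" "card T > dim (f ` K)"
    using card infinite_arbitrarily_large[of "UNIV :: 'a set" "Suc (dim (f ` K))"] card_ge_0_finite
    by (metis gr_implies_not0 lessI neq0_conv)
  \<comment> \<open>\<open>v t\<close> belongs to the eigenvalue \<open>- t\<close>, hence the
    change of sign in the indexing.\<close>
  have "card T \<le> dim (span C)"
  proof (rule card_eigenvalues_le_dim[where f = "\<lambda>v. p (g (h v))" and v = "\<lambda>t. v (- t)"])
    show "Vector_Spaces.linear scale scale (\<lambda>v. p (g (h v)))"
      using Vector_Spaces.linear_compose[OF Vector_Spaces.linear_compose[OF h g] p]
      by (simp add: o_def)
  qed (use v[of "- _"] T in auto)
  then show False
    using T C by simp
qed

end

section \<open>The upper bound for trivial spectrum subspaces\<close>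

locale alternating_form_space = finite_dimensional_vector_space scale Basis
  for scale :: "'f::field \<Rightarrow> 'v::ab_group_add \<Rightarrow> 'v" and Basis +
  fixes s :: "'v \<Rightarrow> 'v \<Rightarrow> 'f"
  assumes bilinear: "bilinear_form scale s"
    and alternating: "alternating s"
begin

lemma linear_form_right: "Vector_Spaces.linear scale (*) (s x)"
  using bilinear by (simp add: bilinear_form_def)

lemma linear_form_left: "Vector_Spaces.linear scale (*) (\<lambda>x. s x y)"
  using bilinear by (simp add: bilinear_form_def)

lemma form_add_right: "s x (y + z) = s x y + s x z"
  using linear_form_right[of x] by (simp add: Vector_Spaces.linear_iff)

lemma form_add_left: "s (x + y) z = s x z + s y z"
  using linear_form_left[of z] by (simp add: Vector_Spaces.linear_iff)

lemma form_scale_right: "s x (scale c y) = c * s x y"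
  using linear_form_right[of x] by (simp add: Vector_Spaces.linear_iff)

lemma form_scale_left: "s (scale c x) y = c * s x y"
  using linear_form_left[of y] by (simp add: Vector_Spaces.linear_iff)

lemma form_zero_right: "s x 0 = 0"
  using form_scale_right[of x 0 0] by simp

lemma form_zero_left: "s 0 x = 0"
  using form_scale_left[of 0 0 x] by simp

lemma form_minus_right: "s x (- y) = - s x y"
  using form_scale_right[of x "-1" y] by simp

lemma form_minus_left: "s (- x) y = - s x y"
  using form_scale_left[of "-1" x y] by simp

lemma form_diff_right: "s x (y - z) = s x y - s x z"
  using form_add_right[of x y "- z"] by (simp add: form_minus_right)

lemma form_diff_left: "s (x - y) z = s x z - s y z"
  using form_add_left[of x "- y" z] by (simp add: form_minus_left)

lemma form_self: "s x x = 0"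
  using alternating by (simp add: alternating_def)

lemma form_swap: "s x y = - s y x"
proof -
  have "s (x + y) (x + y) = 0"
    by (rule form_self)
  then have "s x y + s y x = 0"
    unfolding form_add_left form_add_right by (simp add: form_self add.commute)
  then show ?thesis
    by (simp add: eq_neg_iff_add_eq_0 add.commute)
qed

lemmas form_simps =
  form_add_right form_add_left form_scale_right form_scale_left form_zero_right form_zero_left
  form_minus_right form_minus_left form_diff_right form_diff_left form_self

text \<open>Adjoining first \<open>x\<close> and then \<open>y\<close> to \<open>D\<close> raises
  the dimension each time, since \<open>x\<close> is orthogonal to itself but not to
  \<open>y\<close>. This bounds both the orbit of a vector and the complement of a hyperbolic
  plane.\<close>

lemma dim_add_2_le_if_orthogonal:
  assumes W: "subspace W" and D: "subspace D" "D \<subseteq> W" "\<And>d. d \<in> D \<Longrightarrow> s x d = 0"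
    and x: "x \<in> W" "x \<notin> D" and y: "y \<in> W" "s x y \<noteq> 0"
  shows "dim D + 2 \<le> dim W"
proof -
  have spanD: "span D = D"
    using D(1) by simp
  have "y \<notin> span (insert x D)"
  proof
    assume "y \<in> span (insert x D)"
    then obtain k where "y - scale k x \<in> D"
      by (auto simp: span_breakdown_eq spanD)
    then have "s x (y - scale k x) = 0"
      by (rule D)
    then show False
      using y by (simp add: form_simps)
  qed
  then have "dim (insert y (insert x D)) = dim D + 2"
    using x by (simp add: dim_insert spanD)
  moreover have "insert y (insert x D) \<subseteq> W"
    using x y D by auto
  ultimately show ?thesis
    using dim_subset by metis
qed

text \<open>
  The operators are indexed by a subspace \<open>K\<close> of an auxiliary vector space, so that in the
  induction compressing them to a smaller symplectic subspace does not change the type.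
\<close>

lemma spanning_set_card_le:
  fixes scaleE :: "'f \<Rightarrow> 'e::ab_group_add \<Rightarrow> 'e"
  assumes E: "vector_space scaleE"
    and "module.subspace scaleE K" "subspace W" "dim W \<le> 2 * m"
    and "infinite (UNIV :: 'f set) \<or> card (UNIV :: 'f set) > 2 * m - 2"
    and "\<And>k. k \<in> K \<Longrightarrow> Vector_Spaces.linear scale scale (U k)"
    and "\<And>x. Vector_Spaces.linear scaleE scale (\<lambda>k. U k x)"
    and "\<And>k w. k \<in> K \<Longrightarrow> w \<in> W \<Longrightarrow> U k w \<in> W"
    and "\<And>k w. k \<in> K \<Longrightarrow> w \<in> W \<Longrightarrow> s w (U k w) = 0"
    and "\<And>k w. k \<in> K \<Longrightarrow> w \<in> W \<Longrightarrow> U k w = w \<Longrightarrow> w = 0"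
    and "\<And>k. k \<in> K \<Longrightarrow> (\<And>w. w \<in> W \<Longrightarrow> U k w = 0) \<Longrightarrow> k = 0"
    and "\<And>w. w \<in> W \<Longrightarrow> (\<And>z. z \<in> W \<Longrightarrow> s w z = 0) \<Longrightarrow> w = 0"
  shows "\<exists>B. finite B \<and> B \<subseteq> K \<and> K \<subseteq> module.span scaleE B \<and> card B \<le> m * (m - 1)"
  using assms(2-)
proof (induction m arbitrary: K W U)
  case 0
  then have "W \<subseteq> {0}"
    by simp
  then have "k = 0" if "k \<in> K" for k
    using "0.prems"(5)[OF that] "0.prems"(10)[OF that]
    by (auto dest!: Vector_Spaces.linear.axioms(3) module_hom.zero)
  then show ?case
    using E by (intro exI[of _ "{}"]) (auto simp: module.span_empty module_iff_vector_space)
next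
  case (Suc m)
  interpret E: vector_space scaleE by fact
  interpret EV: vector_space_pair scaleE scale by unfold_locales
  note K = Suc.prems(1) and W = Suc.prems(2) and dimW = Suc.prems(3) and card = Suc.prems(4)
    and linU = Suc.prems(5) and lin_index = Suc.prems(6) and stable = Suc.prems(7)
    and alt = Suc.prems(8) and spec = Suc.prems(9) and faithful = Suc.prems(10)
    and nondeg = Suc.prems(11)
  have U_add: "U k (x + y) = U k x + U k y" and U_scale: "U k (scale c x) = scale c (U k x)"
    if "k \<in> K" for k x y c
    using linU[OF that] by (auto simp: Vector_Spaces.linear_iff)
  have U_zero: "U k 0 = 0" if "k \<in> K" for k
    using U_scale[OF that, of 0 0] by simp
  have U_diff: "U k (x - y) = U k x - U k y" if "k \<in> K" for k x y
    using U_add[OF that, of "x - y" y] by simp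
  have index_add: "U (k + l) x = U k x + U l x" and index_scale: "U (scaleE c k) x = scale c (U k x)"
    for k l x c
    using lin_index[of x] by (auto simp: Vector_Spaces.linear_iff)
  have index_diff: "U (k - l) x = U k x - U l x" for k l x
    using index_add[of "k - l" l x] by simp
  have index_zero: "U 0 x = 0" for x
    using index_diff[of 0 0 x] by simp
  \<comment> \<open>Polarisation of \<open>alt\<close>, combined with the antisymmetry of
    \<open>s\<close>.\<close>
  have self_adjoint: "s (U k w) z = s w (U k z)" if "k \<in> K" "w \<in> W" "z \<in> W" for k w z
  proof -
    have "s (w + z) (U k (w + z)) = 0"
      using that W by (intro alt subspace_add)
    then have "s w (U k z) + s z (U k w) = 0"
      using that by (simp add: U_add form_simps alt add.commute)
    then show ?thesis
      using form_swap[of z "U k w"] by (simp add: add_eq_0_iff)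
  qed
  show ?case
  proof (cases "W \<subseteq> {0}")
    case True
    then have "k = 0" if "k \<in> K" for k
      using faithful that U_zero by blast
    then show ?thesis
      by (intro exI[of _ "{}"]) auto
  next
    case False
    define R where "R x = (\<lambda>k. U k x) ` K" for x
    obtain x\<^sub>0 where "x\<^sub>0 \<in> W \<and> x\<^sub>0 \<noteq> 0"
      using False by auto
    \<comment> \<open>The maximum is taken over nonzero vectors only, because a partner
      \<open>y\<close> with \<open>s x y = 1\<close> is needed; \<open>z = 0\<close> is added
      afterwards.\<close>
    then obtain x where x: "x \<in> W" "x \<noteq> 0"
      and "\<And>z. z \<in> W \<and> z \<noteq> 0 \<Longrightarrow> dim (R z) \<le> dim (R x)"
      using ex_has_greatest_nat[of "\<lambda>z. z \<in> W \<and> z \<noteq> 0" x\<^sub>0 "\<lambda>z. dim (R z)" "Suc dimension",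
          OF _ allI[OF impI[OF le_imp_less_Suc[OF dim_subset_UNIV]]]]
      by metis
    moreover have "R 0 \<subseteq> {0}"
      using U_zero by (auto simp: R_def)
    then have "dim (R 0) = 0"
      by simp
    ultimately have max: "dim (R z) \<le> dim (R x)" if "z \<in> W" for z
      using that by (cases "z = 0") (auto simp del: dim_eq_0)
    obtain y where y: "y \<in> W" "s x y = 1"
    proof -
      obtain z where z: "z \<in> W" "s x z \<noteq> 0"
        using nondeg x by blast
      show ?thesis
      proof (rule that)
        show "scale (1 / s x z) z \<in> W"
          using W z by (intro subspace_scale)
        show "s x (scale (1 / s x z) z) = 1"
          using z by (simp add: form_simps)
      qed
    qed
    have yx: "s y x = - 1"
      using form_swap[of y x] y by simp
    have Rx: "subspace (R x)" "R x \<subseteq> W" "\<And>r. r \<in> R x \<Longrightarrow> s x r = 0" "x \<notin> R x"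
      unfolding R_def using EV.linear_subspace_image[OF lin_index K] stable alt spec x by force+
    \<comment> \<open>For \<open>Suc m\<close> the field is assumed to have more than
      \<open>2 * m\<close> elements, which is what a pencil of this rank requires.\<close>
    have dimRx: "dim (R x) \<le> 2 * m"
      using dim_add_2_le_if_orthogonal[OF W Rx(1-3) x(1) Rx(4) y(1)] y(2) dimW by simp
    \<comment> \<open>The pencil is formed by the evaluations at \<open>z\<close> and at
      \<open>x\<close>: its members are the evaluations at \<open>z + t x\<close>, so their ranks
      are bounded by the choice of \<open>x\<close>.\<close>
    have in_Rx: "U k z \<in> R x" if "k \<in> K" "U k x = 0" "z \<in> W" for k z
      unfolding R_def
    proof (rule kernel_image_in_range_if_rank_maximal[OF E lin_index lin_index K])
      fix t
      have "(\<lambda>k. U k z + scale t (U k x)) ` K = R (z + scale t x)"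
        by (auto simp: R_def U_add U_scale)
      then show "dim ((\<lambda>k. U k z + scale t (U k x)) ` K) \<le> dim ((\<lambda>k. U k x) ` K)"
        using max[of "z + scale t x"] W x that by (simp add: R_def subspace_add subspace_scale)
      show "infinite (UNIV :: 'f set) \<or> dim ((\<lambda>k. U k x) ` K) < card (UNIV :: 'f set)"
        using card dimRx by (auto simp: R_def)
    qed (use that in auto)
    \<comment> \<open>\<open>W'\<close> is the orthogonal complement in \<open>W\<close> of the
      hyperbolic plane spanned by \<open>x\<close> and \<open>y\<close>, a model inside
      \<open>W\<close> of the quotient of the orthogonal of \<open>x\<close> by \<open>F x\<close>.
      \<open>pr\<close> is the orthogonal projection onto it, and \<open>U'\<close> is the
      compression of \<open>U\<close>.\<close>
    define K' where "K' = {k \<in> K. U k x = 0}"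
    define W' where "W' = {w \<in> W. s x w = 0 \<and> s y w = 0}"
    define pr where "pr w = w - scale (s w y) x + scale (s w x) y" for w
    define U' where "U' k w = pr (U k w)" for k w
    have W'D: "s z x = 0" "s z y = 0" if "z \<in> W'" for z
      using that form_swap[of z x] form_swap[of z y] by (auto simp: W'_def)
    have pr_W': "pr w \<in> W'" if "w \<in> W" for w
      using that x y yx W form_swap[of w x] form_swap[of w y]
      by (auto simp: W'_def pr_def form_simps intro!: subspace_add subspace_diff subspace_scale)
    have pr_linear: "Vector_Spaces.linear scale scale pr"
      unfolding Vector_Spaces.linear_iff
      by (auto simp: pr_def vector_space_axioms form_simps algebra_simps)
    \<comment> \<open>Since \<open>U k x = 0\<close>, self-adjointness makes \<open>U k z\<close>
      orthogonal to \<open>x\<close>, so \<open>pr\<close> only subtracts a multiple of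
      \<open>x\<close>.\<close>
    have U'_eq: "U' k z = U k z - scale (s (U k z) y) x" if "k \<in> K'" "z \<in> W'" for k z
    proof -
      have "s (U k z) x = s z (U k x)"
        using that x by (intro self_adjoint) (auto simp: K'_def W'_def)
      then show ?thesis
        using that by (simp add: U'_def pr_def K'_def form_simps)
    qed
    have K'K: "K' \<subseteq> K" and W'W: "W' \<subseteq> W"
      by (auto simp: K'_def W'_def)
    have K': "E.subspace K'"
      using K by (auto simp: K'_def E.subspace_def index_add index_scale index_zero)
    have W': "subspace W'"
      using W by (auto simp: W'_def subspace_def form_simps)
    have "\<exists>B. finite B \<and> B \<subseteq> K' \<and> K' \<subseteq> E.span B \<and> card B \<le> m * (m - 1)"
    proof (rule Suc.IH[where U = U', OF K' W'])
      have "x \<notin> W'"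
        using yx by (auto simp: W'_def)
      then show "dim W' \<le> 2 * m"
        using dim_add_2_le_if_orthogonal[OF W W' W'W _ x(1) _ y(1)] y(2) dimW
        by (auto simp: W'_def)
      show "infinite (UNIV :: 'f set) \<or> 2 * m - 2 < card (UNIV :: 'f set)"
        using card by auto
      show "Vector_Spaces.linear scale scale (U' k)" if "k \<in> K'" for k
        using Vector_Spaces.linear_compose[OF linU[of k] pr_linear] that
        by (simp add: K'_def o_def U'_def[abs_def])
      show "Vector_Spaces.linear scaleE scale (\<lambda>k. U' k w)" for w
        using Vector_Spaces.linear_compose[OF lin_index[of w] pr_linear]
        by (simp add: o_def U'_def)
      show "U' k w \<in> W'" if "k \<in> K'" "w \<in> W'" for k w
        using that stable pr_W' by (auto simp: U'_def K'_def W'_def)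
      show "s w (U' k w) = 0" if "k \<in> K'" "w \<in> W'" for k w
        using that W'D by (simp add: U'_eq form_simps) (simp add: K'_def W'_def alt)
      \<comment> \<open>A fixed vector \<open>w\<close> of the compression lifts to the fixed vector
        \<open>w + c x\<close> of \<open>U k\<close>, which must vanish; pairing it with
        \<open>y\<close> gives \<open>c = 0\<close>.\<close>
      show "w = 0" if k: "k \<in> K'" and w: "w \<in> W'" and fixed: "U' k w = w" for k w
      proof -
        let ?c = "s (U k w) y"
        have kw: "k \<in> K" "U k x = 0" "w \<in> W"
          using k w by (auto simp: K'_def W'_def)
        have "U k w = w + scale ?c x"
          using fixed k w by (simp add: U'_eq diff_eq_eq)
        moreover have "U k (w + scale ?c x) = U k w"
          using kw by (simp add: U_add U_scale)
        moreover have "w + scale ?c x \<in> W"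
          using kw W x by (intro subspace_add subspace_scale)
        ultimately have "w + scale ?c x = 0"
          using spec[OF kw(1)] by metis
        moreover have "s y (w + scale ?c x) = - ?c"
          using w yx by (simp add: form_simps W'_def)
        ultimately show ?thesis
          by (simp add: form_simps)
      qed
      \<comment> \<open>A vanishing compression leaves \<open>U k z\<close> in \<open>F x\<close>
        for \<open>z\<close> in \<open>W'\<close>. By \<open>in_Rx\<close> it also lies in
        \<open>R x\<close>, which does not contain \<open>x\<close>, so it is zero. Then
        \<open>U k y\<close> is orthogonal to all of \<open>W\<close>.\<close>
      show "k = 0" if k: "k \<in> K'" and zero: "\<And>w. w \<in> W' \<Longrightarrow> U' k w = 0" for k
      proof (rule faithful)
        show kK: "k \<in> K"
          using k by (simp add: K'_def)
        have Ux: "U k x = 0"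
          using k by (simp add: K'_def)
        have U_W': "U k z = 0" if z: "z \<in> W'" for z
        proof -
          have eq: "U k z = scale (s (U k z) y) x"
            using zero[OF z] k z by (simp add: U'_eq)
          have "s (U k z) y = 0"
          proof (rule ccontr)
            assume c: "s (U k z) y \<noteq> 0"
            have "scale (1 / s (U k z) y) (U k z) \<in> R x"
              using in_Rx[OF kK Ux] z Rx(1) by (intro subspace_scale) (auto simp: W'_def)
            also have "scale (1 / s (U k z) y) (U k z) = x"
              using c by (subst (2) eq) simp
            finally show False
              using Rx(4) by simp
          qed
          then show ?thesis
            using eq by simp
        qed
        have decomp: "w = pr w + scale (s w y) x - scale (s w x) y" for w
          by (simp add: pr_def)
        have Uy: "U k y = 0"
        proof (rule nondeg)
          show "U k y \<in> W"
            using kK y by (intro stable)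
          fix w assume w: "w \<in> W"
          have "s (U k y) (pr w) = s y (U k (pr w))"
            using kK y pr_W'[OF w] by (intro self_adjoint) (auto simp: W'_def)
          also have "\<dots> = 0"
            using U_W'[OF pr_W'[OF w]] by (simp add: form_simps)
          finally have "s (U k y) (pr w) = 0" .
          moreover have "s (U k y) x = 0"
            using self_adjoint[OF kK y(1) x(1)] Ux by (simp add: form_simps)
          moreover have "s (U k y) y = 0"
            using alt[OF kK y(1)] form_swap[of "U k y" y] by simp
          ultimately show "s (U k y) w = 0"
            by (subst decomp[of w]) (simp add: form_simps)
        qed
        show "U k w = 0" if "w \<in> W" for w
          using that U_W'[OF pr_W'] Ux Uy kK
          by (subst decomp[of w]) (simp add: U_add U_diff U_scale)
      qed
      show "w = 0" if w: "w \<in> W'" and zero: "\<And>z. z \<in> W' \<Longrightarrow> s w z = 0" for w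
      proof (rule nondeg)
        show "w \<in> W"
          using w by (simp add: W'_def)
        show "s w z = 0" if "z \<in> W" for z
          using zero[OF pr_W'[OF that]] W'D[OF w] by (simp add: pr_def form_simps)
      qed
    qed
    then obtain B where B: "finite B" "B \<subseteq> K'" "K' \<subseteq> E.span B" "card B \<le> m * (m - 1)"
      by blast
    obtain C where C: "finite C" "C \<subseteq> R x" "span C = R x" "card C = dim (R x)"
      using basis_subspace_exists[OF Rx(1)] by metis
    \<comment> \<open>Rank-nullity for the evaluation at \<open>x\<close>: \<open>B\<close> spans
      its kernel \<open>K'\<close>, and \<open>l\<close> lifts a basis of its range.\<close>
    then have "\<forall>c\<in>C. \<exists>k\<in>K. U k x = c"
      by (auto simp: R_def)
    then obtain l where l: "\<And>c. c \<in> C \<Longrightarrow> l c \<in> K \<and> U (l c) x = c"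
      by metis
    have "(\<lambda>k. U k x) ` l ` C = C"
      using l by (force simp: image_image)
    then have image: "(\<lambda>k. U k x) ` E.span (l ` C) = R x"
      using EV.linear_span_image[OF lin_index[of x], of "l ` C"] C(3) by simp
    have "k \<in> E.span (B \<union> l ` C)" if k: "k \<in> K" for k
    proof -
      have "U k x \<in> (\<lambda>k. U k x) ` E.span (l ` C)"
        using k image by (simp add: R_def)
      then obtain j where j: "j \<in> E.span (l ` C)" "U j x = U k x"
        by (metis imageE)
      have "E.span (l ` C) \<subseteq> K"
        using l K by (intro E.span_minimal) auto
      then have "k - j \<in> K'"
        using k j K by (auto simp: K'_def index_diff intro: E.subspace_diff)
      then have "k - j \<in> E.span (B \<union> l ` C)"
        using B(3) E.span_mono[of B "B \<union> l ` C"] by auto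
      moreover have "j \<in> E.span (B \<union> l ` C)"
        using j E.span_mono[of "l ` C" "B \<union> l ` C"] by auto
      ultimately show ?thesis
        using E.span_add[of "k - j" _ j] by simp
    qed
    moreover have "card (B \<union> l ` C) \<le> Suc m * (Suc m - 1)"
    proof -
      have "card (B \<union> l ` C) \<le> card B + card (l ` C)"
        by (rule card_Un_le)
      also have "\<dots> \<le> m * (m - 1) + 2 * m"
        using B(4) C(4) dimRx card_image_le[OF C(1), of l] by linarith
      also have "\<dots> = Suc m * (Suc m - 1)"
        by (cases m) (auto simp: algebra_simps)
      finally show ?thesis .
    qed
    ultimately show ?thesis
      using B(1,2) C(1) l K'K by (intro exI[of _ "B \<union> l ` C"]) auto
  qed
qed

end

section \<open>Alternating forms over the quadratic extension\<close>

text \<open>By dimension, \<open>id\<close>, \<open>a\<close> and \<open>a \<circ> a\<close> are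
  dependent, while \<open>a\<close> is not a scalar. A root \<open>c\<close> of the resulting
  polynomial would give the product zero of the nonzero elements \<open>a - c\<close> and
  \<open>a - (t - c)\<close> of the field \<open>L\<close>.\<close>

lemma quadratic_extension_minimal_polynomial:
  fixes scale :: "'f::field \<Rightarrow> 'v::ab_group_add \<Rightarrow> 'v"
  assumes V: "vector_space scale" and L: "quadratic_extension scale L"
    and adj: "L = adjoin scale a"
  obtains t N where "\<And>x. a (a x) = scale t (a x) - scale N x" "\<And>c. c * c - t * c + N \<noteq> 0"
proof -
  interpret vector_space scale by fact
  interpret E: vector_space "fun_scale scale"
    by (rule vector_space_fun_scale) fact
  have L_sub: "E.subspace L" and dimL: "E.dim L = 2"
    and L_comm: "\<And>u v. u \<in> L \<Longrightarrow> v \<in> L \<Longrightarrow> u \<circ> v = v \<circ> u"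
    and L_inv: "\<And>u. u \<in> L \<Longrightarrow> u \<noteq> 0 \<Longrightarrow> \<exists>v\<in>L. u \<circ> v = id"
    using L by (auto simp: quadratic_extension_def end_subalgebra_def end_subspace_def end_dim_def)
  have pow: "a ^^ k \<in> L" for k
    unfolding adj adjoin_def by (intro E.span_base) simp
  have L1: "id \<in> L" "a \<in> L" "a \<circ> a \<in> L"
    using pow[of 0] pow[of 1] pow[of 2] by (simp_all add: numeral_2_eq_2)
  have a_not_scalar: "a \<notin> E.span {id}"
  proof
    assume "a \<in> E.span {id}"
    then obtain c where c: "a = fun_scale scale c id"
      by (auto simp: E.span_singleton)
    have "a ^^ k = fun_scale scale (c ^ k) id" for k
      by (induction k) (simp_all add: c fun_scale_def fun_eq_iff)
    then have "range (\<lambda>k. a ^^ k) \<subseteq> E.span {id}"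
      by (auto simp: E.span_singleton)
    then have "L \<subseteq> E.span {id}"
      unfolding adj adjoin_def by (intro E.span_minimal) auto
    then have "E.dim L \<le> 1"
      using E.dim_le_card[of L "{id}"] by simp
    then show False
      using dimL by simp
  qed
  have id0: "(id :: 'v \<Rightarrow> 'v) \<noteq> 0"
    using L by (simp add: quadratic_extension_def)
  have "a \<circ> a \<in> E.span {a, id}"
  proof (rule ccontr)
    assume aa: "a \<circ> a \<notin> E.span {a, id}"
    have ind: "E.independent {a \<circ> a, a, id}"
      using aa a_not_scalar id0 by (intro E.independent_insertI) (auto simp: E.independent_empty)
    have "a \<noteq> id" "a \<circ> a \<noteq> a" "a \<circ> a \<noteq> id"
      using a_not_scalar aa E.span_base[of _ "{a, id}"] E.span_base[of id "{id}"] by auto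
    then have "card {a \<circ> a, a, id} = 3"
      by simp
    moreover obtain B where B: "B \<subseteq> L" "E.independent B" "L \<subseteq> E.span B" "card B = 2"
      using E.basis_exists[of L] dimL by metis
    then have "finite B"
      by (intro card_ge_0_finite) simp
    then have "card {a \<circ> a, a, id} \<le> 2"
      using E.independent_span_bound[OF _ ind, of B] B L1 by auto
    ultimately show False
      by simp
  qed
  then obtain t N where "(a \<circ> a) - fun_scale scale t a = fun_scale scale N id"
    by (auto simp: E.span_breakdown_eq E.span_singleton)
  then have aa: "a (a x) = scale t (a x) + scale N x" for x
    by (auto simp: fun_eq_iff fun_scale_def algebra_simps)
  have "c * c - t * c + - N \<noteq> 0" for c
  proof
    assume c: "c * c - t * c + - N = 0"
    define shift where "shift d = a - fun_scale scale d id" for d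
    have shift: "shift d \<in> L" "shift d \<noteq> 0" for d
    proof -
      show "shift d \<in> L"
        unfolding shift_def by (intro E.subspace_diff E.subspace_scale L_sub L1)
      show "shift d \<noteq> 0"
        using a_not_scalar E.span_scale[OF E.span_base[of id "{id}"], of d] by (auto simp: shift_def)
    qed
    obtain v where v: "v \<in> L" "shift c \<circ> v = id"
      using L_inv[OF shift] by auto
    have lin: "Vector_Spaces.linear scale scale a"
      using L L1 by (auto simp: quadratic_extension_def end_subalgebra_def end_subspace_def End_def)
    have "shift c (shift (t - c) x) = 0" for x
    proof -
      have "shift c (shift (t - c) x) = scale (N - c * c + t * c) x"
        using lin unfolding Vector_Spaces.linear_iff
        by (simp add: shift_def fun_scale_def module_hom.diff[OF Vector_Spaces.linear.axioms(3)[OF lin]]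
            aa algebra_simps)
      then show ?thesis
        using c by (simp add: algebra_simps)
    qed
    \<comment> \<open>The factors are exchanged because \<open>v\<close> is a right inverse of
      \<open>shift c\<close>: evaluation at \<open>v x\<close> then cancels
      \<open>shift c\<close>.\<close>
    then have "shift (t - c) (shift c x) = 0" for x
      using L_comm[OF shift(1) shift(1), of c "t - c"] by (metis comp_apply)
    then have "shift (t - c) x = 0" for x
      using v(2) by (metis comp_apply id_apply)
    then show False
      using shift(2)[of "t - c"] by (auto simp: fun_eq_iff)
  qed
  then show thesis
    using that[of t "- N"] aa by simp
qed

text \<open>Each \<open>\<phi> p\<close> isolates one coefficient of a linear relation.\<close>

lemma (in vector_space) independent_if_biorthogonal:
  assumes "finite I" and lin: "\<And>p. p \<in> I \<Longrightarrow> Vector_Spaces.linear scale (*) (\<phi> p)"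
    and \<phi>: "\<And>p q. p \<in> I \<Longrightarrow> q \<in> I \<Longrightarrow> \<phi> p (v q) = (if p = q then 1 else 0)"
  shows "inj_on v I" "independent (v ` I)"
proof -
  show inj: "inj_on v I"
    using \<phi> by (intro inj_onI) (metis zero_neq_one)
  show "independent (v ` I)"
  proof (rule independent_if_scalars_zero)
    show "finite (v ` I)"
      using \<open>finite I\<close> by simp
    fix c x assume sum: "(\<Sum>x\<in>v ` I. scale (c x) x) = 0" and "x \<in> v ` I"
    then obtain p where p: "p \<in> I" "x = v p"
      by auto
    interpret \<phi>: Vector_Spaces.linear scale "(*)" "\<phi> p"
      using lin p by auto
    have "0 = \<phi> p (\<Sum>q\<in>I. scale (c (v q)) (v q))"
      using sum by (simp add: sum.reindex[OF inj])
    also have "\<dots> = (\<Sum>q\<in>I. if q = p then c (v q) else 0)"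
      using \<phi> p by (auto simp: \<phi>.sum \<phi>.scale intro!: sum.cong)
    also have "\<dots> = c x"
      using p \<open>finite I\<close> by simp
    finally show "c x = 0"
      by simp
  qed
qed

lemma subspace_alt_end:
  assumes "vector_space scale" "bilinear_form scale b"
  shows "module.subspace (fun_scale scale) (alt_end scale b)"
proof -
  interpret vector_space scale by fact
  interpret E: vector_space "fun_scale scale"
    by (rule vector_space_fun_scale) fact
  have b: "b x (y + z) = b x y + b x z" "b x (scale c y) = c * b x y" for x y z c
    using assms(2) by (auto simp: bilinear_form_def Vector_Spaces.linear_iff)
  have "b x 0 = 0" for x
    using b(2)[of x 0 0] by simp
  then show ?thesis
    using subspace_End[OF assms(1)]
    by (auto simp: E.subspace_def alt_end_def b fun_scale_def)
qed

text \<open>Of the quadratic extension only the polynomial \<open>X^2 - t X + N\<close> annihilating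
  \<open>a\<close> is retained; having degree 2 and no root, it is irreducible.\<close>

locale quadratic_symplectic_space = alternating_form_space scale Basis s
  for scale :: "'f::field \<Rightarrow> 'v::ab_group_add \<Rightarrow> 'v" and Basis s +
  fixes a :: "'v \<Rightarrow> 'v" and t N :: 'f
  assumes nondegenerate: "nondegenerate s"
    and linear_a: "Vector_Spaces.linear scale scale a"
    and a_a: "a (a x) = scale t (a x) - scale N x"
    and no_root: "c * c - t * c + N \<noteq> 0"
begin

sublocale a: Vector_Spaces.linear scale scale a
  by (rule linear_a)

sublocale E: vector_space "fun_scale scale"
  by (rule vector_space_fun_scale) (rule vector_space_axioms)

lemma nondegenerate_right: "(\<And>y. s y x = 0) \<Longrightarrow> x = 0"
  using nondegenerate by (auto simp: nondegenerate_def)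

lemma nondegenerate_left: "(\<And>y. s x y = 0) \<Longrightarrow> x = 0"
  using nondegenerate by (auto simp: nondegenerate_def)

text \<open>Up to a scalar that is nonzero by \<open>no_root\<close>, \<open>a - (t - c)\<close> is
  an inverse of \<open>a - c\<close>. The next two lemmas rest on this.\<close>

lemma shift_shift:
  "a (a x - scale c x) - scale (t - c) (a x - scale c x) = scale (- (c * c - t * c + N)) x"
  by (simp add: a.diff a.scale a_a algebra_simps)

lemma in_invariant_subspace_if_shift_in:
  assumes U: "subspace U" and stable: "\<And>x. x \<in> U \<Longrightarrow> a x \<in> U" and x: "a x - scale c x \<in> U"
  shows "x \<in> U"
proof -
  define d where "d = - (c * c - t * c + N)"
  have d: "d \<noteq> 0"
    using no_root[of c] unfolding d_def neg_equal_0_iff_equal .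
  have "scale d x \<in> U"
    unfolding d_def shift_shift[symmetric]
    using subspace_diff[OF U stable[OF x] subspace_scale[OF U x]] .
  then have "scale (inverse d) (scale d x) \<in> U"
    using subspace_scale[OF U] by blast
  then show ?thesis
    using d by simp
qed

lemma surj_shift: "\<exists>x. a x - scale c x = y"
proof -
  define d where "d = - (c * c - t * c + N)"
  let ?x = "a y - scale (t - c) y"
  have d: "d \<noteq> 0"
    using no_root[of c] unfolding d_def neg_equal_0_iff_equal .
  have "a ?x - scale c ?x = scale d y"
    by (simp add: d_def a.add a.diff a.scale a_a algebra_simps)
  then have "a (scale (inverse d) ?x) - scale c (scale (inverse d) ?x) = scale (inverse d) (scale d y)"
    by (simp only: a.scale scale_left_commute[of c] scale_right_diff_distrib[symmetric])
  then show ?thesis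
    using d by (metis left_inverse scale_one scale_scale)
qed

text \<open>
  Identify \<open>x \<otimes> y\<close> with \<open>z \<mapsto> s x z \<cdot> y\<close> and let \<open>x \<and> y = x \<otimes> y - y \<otimes> x\<close>. The operator below is
  \<open>x \<and> (a - t) y + a x \<and> y\<close>; it comes from the Casimir element \<open>1 \<otimes> (a - t) + a \<otimes> 1\<close> of
  \<open>F[a] \<otimes> F[a]\<close>, whose product with \<open>1 \<otimes> a\<close> is \<open>a \<otimes> a - N\<close> and hence symmetric.
\<close>

definition casimir_wedge :: "'v \<Rightarrow> 'v \<Rightarrow> 'v \<Rightarrow> 'v" where
  "casimir_wedge x y z =
     scale (s x z) (a y - scale t y) - scale (s (a y - scale t y) z) x
     + scale (s (a x) z) y - scale (s y z) (a x)"

lemma casimir_wedge_mem: "casimir_wedge x y \<in> alt_end scale s \<inter> alt_end scale (twist s a)"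
proof -
  have "Vector_Spaces.linear scale scale (casimir_wedge x y)"
    unfolding Vector_Spaces.linear_iff
    by (auto simp: casimir_wedge_def vector_space_axioms form_simps algebra_simps)
  moreover have "s z (casimir_wedge x y z) = 0" for z
    unfolding casimir_wedge_def
    by (simp add: form_simps form_swap[of z x] form_swap[of z y] form_swap[of z "a x"]
        form_swap[of z "a y"] algebra_simps)
  moreover have "s z (a (casimir_wedge x y z)) = 0" for z
    unfolding casimir_wedge_def
    by (simp add: form_simps a.diff a.add a.scale a_a form_swap[of z x] form_swap[of z y]
        form_swap[of z "a x"] form_swap[of z "a y"] algebra_simps)
  ultimately show ?thesis
    by (simp add: alt_end_def End_def twist_def)
qed

lemma fixed_vector_if_isotropic:
  assumes x: "x \<noteq> 0" "s x (a x) = 0"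
  shows "\<exists>u \<in> alt_end scale s \<inter> alt_end scale (twist s a). u x = x"
proof -
  \<comment> \<open>Otherwise the functional \<open>s (a _) x\<close> is a multiple \<open>c\<close>
    of \<open>s _ x\<close>, so the surjective map \<open>a - c\<close> has its range in the kernel
    of \<open>s _ x\<close>, against nondegeneracy. After rescaling \<open>y\<close> to
    \<open>z\<close>, only the second term of \<open>casimir_wedge x z x\<close> survives.\<close>
  have "\<exists>y. s y x = 0 \<and> s (a y) x \<noteq> 0"
  proof (rule ccontr)
    assume "\<not> ?thesis"
    then have *: "s (a y) x = 0" if "s y x = 0" for y
      using that by auto
    obtain w where w: "s w x \<noteq> 0"
      using nondegenerate_right x by blast
    define c where "c = s (a w) x / s w x"
    have "s (a y - scale c y) x = 0" for y
      using *[of "y - scale (s y x / s w x) w"] w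
      by (simp add: form_simps a.diff a.scale c_def field_simps)
    then have "s z x = 0" for z
      using surj_shift[of c z] by metis
    then show False
      using nondegenerate_right x by blast
  qed
  then obtain y where y: "s y x = 0" "s (a y) x \<noteq> 0"
    by blast
  define z where "z = scale (- 1 / s (a y) x) y"
  have "s z x = 0" "s (a z) x = - 1"
    using y by (auto simp: z_def form_simps a.scale a.neg)
  moreover have "s (a x) x = 0"
    using form_swap[of "a x" x] x by simp
  ultimately have "casimir_wedge x z x = x"
    by (simp add: casimir_wedge_def form_simps)
  then show ?thesis
    using casimir_wedge_mem by blast
qed

section \<open>Bases over the extension and the lower bound for the dimension\<close>

text \<open>The pairings with \<open>B\<close>, taken as coordinates with respect to
  \<open>B\<close>, define an endomorphism that is injective by nondegeneracy and hence
  surjective.\<close>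

lemma dual_basis_exists:
  assumes B: "independent B" "span B = UNIV"
  shows "\<exists>z. \<forall>b\<in>B. \<forall>c\<in>B. s b (z c) = (if b = c then 1 else 0)"
proof -
  have fin: "finite B"
    using B finiteI_independent by auto
  define f where "f z = (\<Sum>b\<in>B. scale (s b z) b)" for z
  have f: "Vector_Spaces.linear scale scale f"
    unfolding Vector_Spaces.linear_iff
    by (auto simp: f_def vector_space_axioms form_simps scale_left_distrib sum.distrib scale_sum_right)
  interpret f: Vector_Spaces.linear scale scale f by fact
  have coeff: "s b z = c b" if "f z = (\<Sum>b\<in>B. scale (c b) b)" "b \<in> B" for z b c
  proof -
    have "(\<Sum>b\<in>B. scale (s b z - c b) b) = 0"
      using that by (simp add: f_def scale_left_diff_distrib sum_subtractf)
    then show ?thesis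
      using independentD[OF B(1) fin order_refl _ that(2), of "\<lambda>b. s b z - c b"] by simp
  qed
  have "z = 0" if "f z = 0" for z
  proof (rule nondegenerate_right)
    fix y
    have "y \<in> span B"
      using B by simp
    then show "s y z = 0"
      by (induction rule: span_induct_alt)
        (use coeff[of z "\<lambda>_. 0"] that in \<open>auto simp: form_simps\<close>)
  qed
  then have "inj f"
    by (simp add: f.inj_iff_eq_0)
  then have "surj f"
    using linear_inj_imp_surj[OF f] by simp
  then obtain z where z: "\<And>c. f (z c) = c"
    by (metis surjD)
  have "s b (z c) = (if b = c then 1 else 0)" if "b \<in> B" "c \<in> B" for b c
    using coeff[of "z c" "\<lambda>b. if b = c then 1 else 0" b] that fin
    by (simp add: z if_distrib[of "\<lambda>x. scale x _"] cong: if_cong)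
  then show ?thesis
    by blast
qed

text \<open>Greedy choice of vectors independent over \<open>F[a]\<close>: if \<open>w\<close> lies
  outside the \<open>a\<close>-stable space \<open>span S\<close>, then so does every
  \<open>a w - c w\<close>, hence both \<open>w\<close> and \<open>a w\<close> raise the
  dimension.\<close>

lemma extension_basis_exists:
  assumes "2 * k \<le> dimension"
  shows "\<exists>v. dim (v ` {..<k} \<union> (\<lambda>i. a (v i)) ` {..<k}) = 2 * k"
  using assms
proof (induction k)
  case 0
  then show ?case by simp
next
  case (Suc k)
  then obtain v where v: "dim (v ` {..<k} \<union> (\<lambda>i. a (v i)) ` {..<k}) = 2 * k"
    by auto
  define S where "S = v ` {..<k} \<union> (\<lambda>i. a (v i)) ` {..<k}"
  have "span S \<noteq> UNIV"
    using v Suc.prems dim_eq_full[of S] by (auto simp: S_def)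
  then obtain w where w: "w \<notin> span S"
    by auto
  have *: "v i \<in> span S" "a (v i) \<in> span S" if "i < k" for i
    using that by (auto simp: S_def intro: span_base)
  have "a x \<in> span S" if "x \<in> S" for x
  proof -
    obtain i where "i < k" "x = v i \<or> x = a (v i)"
      using \<open>x \<in> S\<close> by (auto simp: S_def)
    then show ?thesis
      using * by (auto simp: a_a intro!: span_diff span_scale)
  qed
  then have "a ` span S \<subseteq> span S"
    unfolding a.span_image[symmetric] by (intro span_minimal) auto
  then have "a w - scale c w \<notin> span S" for c
    using in_invariant_subspace_if_shift_in[of "span S" w c] w by auto
  then have aw: "a w \<notin> span (insert w S)"
    by (auto simp: span_breakdown_eq)
  let ?v = "v(k := w)"
  have "?v ` {..<Suc k} \<union> (\<lambda>i. a (?v i)) ` {..<Suc k} = insert (a w) (insert w S)"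
    by (auto simp: S_def lessThan_Suc)
  moreover have "dim (insert (a w) (insert w S)) = 2 * Suc k"
    using aw w v by (simp add: dim_insert S_def)
  ultimately show ?case
    by metis
qed

lemma independent_casimir_wedges:
  assumes n: "dimension = 2 * n"
  shows "\<exists>X \<subseteq> alt_end scale s \<inter> alt_end scale (twist s a).
    finite X \<and> E.independent X \<and> card X = n * (n - 1)"
proof -
  obtain v where v: "dim (v ` {..<n} \<union> (\<lambda>i. a (v i)) ` {..<n}) = 2 * n"
    using extension_basis_exists[of n] n by auto
  \<comment> \<open>\<open>e\<close> enumerates the basis of all \<open>v i\<close> and
    \<open>a (v i)\<close>; counting shows that it is injective, so the dual basis can be indexed by
    the same pairs.\<close>
  define e where "e = (\<lambda>(i, b). if b then a (v i) else v i)"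
  let ?J = "{..<n} \<times> (UNIV :: bool set)"
  have eJ: "e ` ?J = v ` {..<n} \<union> (\<lambda>i. a (v i)) ` {..<n}"
    by (force simp: e_def UNIV_bool image_iff)
  have dim: "dim (e ` ?J) = 2 * n"
    using v eJ by simp
  have "card (e ` ?J) \<le> card ?J"
    by (intro card_image_le) simp
  moreover have "card ?J = 2 * n"
    by (simp add: card_cartesian_product)
  moreover have "dim (e ` ?J) \<le> card (e ` ?J)"
    by (intro dim_le_card') simp
  ultimately have card: "card (e ` ?J) = 2 * n" and inj: "inj_on e ?J"
    using dim by (auto intro: eq_card_imp_inj_on)
  have span: "span (e ` ?J) = UNIV"
    using dim n dim_eq_full by metis
  have "independent (e ` ?J)"
    using card n span by (intro card_le_dim_spanning[of _ UNIV]) (auto simp: dimension_def)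
  then obtain z where z: "\<And>p q. p \<in> ?J \<Longrightarrow> q \<in> ?J \<Longrightarrow> s (e p) (z (e q)) = (if e p = e q then 1 else 0)"
    using dual_basis_exists[OF _ span] by blast
  define y where "y p = z (e p)" for p
  have y: "s (e p) (y q) = (if p = q then 1 else 0)" if "p \<in> ?J" "q \<in> ?J" for p q
    using z[OF that] inj that by (auto simp: y_def inj_on_eq_iff)
  have dual:
    "s (v i) (y (j, b)) = (if i = j \<and> \<not> b then 1 else 0)"
    "s (a (v i)) (y (j, b)) = (if i = j \<and> b then 1 else 0)"
    if "i < n" "j < n" for i j b
    using y[of "(i, False)" "(j, b)"] y[of "(i, True)" "(j, b)"] that
    by (auto simp: e_def)
  \<comment> \<open>Pairs \<open>i < j\<close>, with a Boolean choosing \<open>v i\<close> or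
    \<open>a (v i)\<close> as first factor: twice \<open>n (n - 1) / 2\<close> operators.\<close>
  define I where "I = (SIGMA j:{..<n}. {..<j}) \<times> (UNIV :: bool set)"
  define m where "m = (\<lambda>((j, i), b). casimir_wedge (if b then a (v i) else v i) (v j))"
  \<comment> \<open>This reads off the coefficient of \<open>a (v j)\<close> in
    \<open>u (y (i, b))\<close>. In a Casimir wedge the first term supplies the Kronecker delta, the
    third yields only multiples of some \<open>v j\<close>, and the other two would need the roles
    of \<open>i\<close> and \<open>j\<close> exchanged, which \<open>i < j\<close> excludes.\<close>
  define \<phi> where "\<phi> = (\<lambda>((j, i), b) u. s (u (y (i, b))) (y (j, True)))"
  have lin: "Vector_Spaces.linear (fun_scale scale) (*) (\<phi> p)" for p
    unfolding Vector_Spaces.linear_iff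
    using E.vector_space_axioms Vector_Spaces.linear_iff[THEN iffD1, OF linear_form_right]
    by (auto simp: \<phi>_def fun_scale_def form_simps split: prod.splits)
  have biorth: "\<phi> p (m q) = (if p = q then 1 else 0)" if "p \<in> I" "q \<in> I" for p q
    using that
    by (auto simp: I_def \<phi>_def m_def casimir_wedge_def form_simps dual a_a split: if_splits)
  have fin: "finite I"
    by (simp add: I_def)
  note X = E.independent_if_biorthogonal[OF fin lin biorth]
  have "2 * (\<Sum>j<n. j) = n * (n - 1)"
    by (induction n) (auto simp: algebra_simps)
  then have "card I = n * (n - 1)"
    by (simp add: I_def card_cartesian_product mult.commute)
  moreover have "m ` I \<subseteq> alt_end scale s \<inter> alt_end scale (twist s a)"
    using casimir_wedge_mem by (auto simp: m_def simp del: Int_iff)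
  ultimately show ?thesis
    using X fin by (intro exI[of _ "m ` I"]) (simp add: card_image)
qed

end

theorem proposition1p13:
  fixes scale :: "'f::field \<Rightarrow> 'v::ab_group_add \<Rightarrow> 'v"
    and s :: "'v \<Rightarrow> 'v \<Rightarrow> 'f"
    and L :: "('v \<Rightarrow> 'v) set"
    and a :: "'v \<Rightarrow> 'v"
    and n :: nat
  assumes "vector_space scale"
    and "vector_space.dim scale (UNIV :: 'v set) = 2 * n"
    and "2 * n \<ge> 4"
    and "infinite (UNIV :: 'f set) \<or> card (UNIV :: 'f set) > 2 * n - 2"
    and "symplectic_form scale s"
    and "quadratic_extension scale L"
    and "a \<in> End scale"
    and "L = adjoin scale a"
  shows "optimal_trivial_spectrum scale s (alt_end scale s \<inter> alt_end scale (twist s a))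
         \<longleftrightarrow> nonisotropic (twist s a)"
proof -
  interpret V: vector_space scale by fact
  obtain Basis where Basis: "V.independent Basis" "V.span Basis = UNIV" "card Basis = 2 * n"
    using V.basis_exists[of UNIV] assms(2) by (metis top.extremum_unique)
  then have "finite Basis"
    using assms(3) by (intro card_ge_0_finite) simp
  obtain t N where "\<And>x. a (a x) = scale t (a x) - scale N x" "\<And>c. c * c - t * c + N \<noteq> 0"
    using quadratic_extension_minimal_polynomial[OF assms(1,6,8)] by blast
  then interpret quadratic_symplectic_space scale Basis s a t N
    using Basis \<open>finite Basis\<close> assms(5,7)
    by unfold_locales (auto simp: symplectic_form_def End_def Vector_Spaces.linear_iff)
  have dim: "dimension = 2 * n"
    using Basis by (simp add: dimension_def)
  let ?A = "alt_end scale s \<inter> alt_end scale (twist s a)"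
  show ?thesis
  proof
    assume opt: "optimal_trivial_spectrum scale s ?A"
    show "nonisotropic (twist s a)"
      unfolding nonisotropic_def
    proof (intro allI impI notI)
      fix x assume "x \<noteq> 0" "twist s a x x = 0"
      then obtain u where u: "u \<in> ?A" "u x = x"
        using fixed_vector_if_isotropic[of x] by (auto simp: twist_def)
      then obtain w where "w \<circ> (id - u) = id" "w \<in> End scale"
        using opt by (auto simp: optimal_trivial_spectrum_def trivial_spectrum_def end_invertible_def)
      \<comment> \<open>\<open>id - u\<close> kills \<open>x\<close>, so its left inverse
        \<open>w\<close> would have to send \<open>0\<close> to \<open>x\<close>.\<close>
      then have "w 0 = x" "w 0 = 0"
        using u(2) by (auto simp: fun_eq_iff End_def Vector_Spaces.linear_iff
            dest: spec[of _ x] spec[of _ 0])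
      then show False
        using \<open>x \<noteq> 0\<close> by simp
    qed
  next
    assume aniso: "nonisotropic (twist s a)"
    have "bilinear_form scale (twist s a)"
      unfolding bilinear_form_def twist_def Vector_Spaces.linear_iff
      using assms(1) linear_form_right[THEN Vector_Spaces.linear_iff[THEN iffD1]]
      by (auto simp: form_simps a.add a.scale)
    then have subspace: "E.subspace ?A"
      using subspace_alt_end[OF assms(1)] bilinear by (intro E.subspace_inter) auto
    have invertible: "end_invertible scale (id - u)" if u: "u \<in> ?A" for u
    proof -
      have lin: "Vector_Spaces.linear scale scale u"
        using u by (simp add: alt_end_def End_def)
      have lin': "Vector_Spaces.linear scale scale (id - u)"
        using lin unfolding Vector_Spaces.linear_iff by (auto simp: algebra_simps)
      have "x = 0" if "(id - u) x = 0" for x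
      proof -
        have "u x = x"
          using that by simp
        then have "twist s a x x = 0"
          using u by (auto simp: alt_end_def dest: spec[of _ x])
        then show ?thesis
          using aniso by (auto simp: nonisotropic_def)
      qed
      then have inj: "inj (id - u)"
        using module_hom.inj_iff_eq_0[OF Vector_Spaces.linear.axioms(3)[OF lin']] by blast
      then have "(id - u) \<circ> inv (id - u) = id" "inv (id - u) \<circ> (id - u) = id"
        using linear_inj_imp_surj[OF lin' inj] by (simp_all only: surj_iff inv_o_cancel[OF inj])
      moreover have "inv (id - u) \<in> End scale"
        using inj_linear_imp_inv_linear[OF lin' inj] by (simp add: End_def)
      ultimately show ?thesis
        unfolding end_invertible_def by blast
    qed
    have trivial: "trivial_spectrum scale ?A"
      using subspace invertible by (auto simp: trivial_spectrum_def end_subspace_def alt_end_def)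
    have bound: "\<exists>B. finite B \<and> B \<subseteq> T \<and> T \<subseteq> E.span B \<and> card B \<le> n * (n - 1)"
      if T: "trivial_spectrum scale T" "T \<subseteq> alt_end scale s" for T
    \<comment> \<open>The operators serve as their own index space, and \<open>W\<close> is the
      whole space.\<close>
    proof (rule spanning_set_card_le[where W = UNIV and U = "\<lambda>k. k", OF E.vector_space_axioms])
      show "E.subspace T"
        using T by (simp add: trivial_spectrum_def end_subspace_def)
      show "V.dim UNIV \<le> 2 * n"
        using assms(2) by simp
      show "Vector_Spaces.linear scale scale k" if "k \<in> T" for k
        using T that by (auto simp: alt_end_def End_def)
      show "Vector_Spaces.linear (fun_scale scale) scale (\<lambda>k. k x)" for x
        unfolding Vector_Spaces.linear_iff
        using E.vector_space_axioms assms(1) by (simp add: fun_scale_def)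
      show "s w (k w) = 0" if "k \<in> T" for k w
        using T that by (auto simp: alt_end_def)
      show "w = 0" if k: "k \<in> T" and w: "k w = w" for k w
      proof -
        obtain v where "v \<circ> (id - k) = id" "v \<in> End scale"
          using T k by (auto simp: trivial_spectrum_def end_invertible_def)
        then have "v 0 = w" "v 0 = 0"
          using w by (auto simp: fun_eq_iff End_def Vector_Spaces.linear_iff
              dest: spec[of _ w] spec[of _ 0])
        then show ?thesis
          by simp
      qed
      show "w = 0" if "\<And>z. z \<in> UNIV \<Longrightarrow> s w z = 0" for w
        using that nondegenerate_left by blast
    qed (use assms(4) in \<open>auto simp: fun_eq_iff\<close>)
    \<comment> \<open>The space of all maps on \<open>V\<close> need not be finite-dimensional, so
      the upper bound first provides a finite spanning set; this makes the basis \<open>C\<close>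
      finite and lets its size be compared with \<open>X\<close>.\<close>
    have "n * (n - 1) \<le> E.dim ?A"
    proof -
      obtain X where X: "X \<subseteq> ?A" "E.independent X" "card X = n * (n - 1)"
        using independent_casimir_wedges[OF dim] by blast
      obtain B where B: "finite B" "?A \<subseteq> E.span B"
        using bound[OF trivial] by blast
      obtain C where C: "C \<subseteq> ?A" "E.independent C" "?A \<subseteq> E.span C" "card C = E.dim ?A"
        using E.basis_exists[of ?A] by blast
      have "finite C"
        using E.independent_span_bound[OF B(1) C(2)] C(1) B(2) by blast
      then show ?thesis
        using E.independent_span_bound[OF _ X(2), of C] X C by auto
    qed
    moreover have "E.dim T \<le> n * (n - 1)" if "trivial_spectrum scale T" "T \<subseteq> alt_end scale s" for T
      using bound[OF that] E.dim_le_card[of T] by (meson le_trans)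
    ultimately show "optimal_trivial_spectrum scale s ?A"
      using trivial by (fastforce simp: optimal_trivial_spectrum_def end_dim_def)
  qed
qed

end
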